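(* For all integers $k\ge2$ and all integers $n\ge1$, $k\Sigma_0\models\neg TR^n$.
   Context: Structures and semantics: second-order formulas are built from individual variables, $n$-ary predicate variables for each $n\ge1$ ("variables of sort $n$"), identity between individuals, connectives, and quantifiers over individual variables and over predicate variables. For a non-empty set $I$, an $n$-ary predicate on $I$ is a function $\alpha:I^n\to\{true,false\}$, identified with a subset of $I^n$. A predicate structure over $I$ is a sequence $\Sigma=(J_n)_{n\ge0}$ with $J_0=I$ and each $J_n$ ($n\ge1$) a non-empty set of $n$-ary predicates on $I$. Individual variables range over $J_0$ and predicate variables of sort $n$ range over $J_n$ (Henkin semantics). $\Sigma\models\varphi$ means that $\varphi$ is true in $\Sigma$ under every assignment. The model $k\Sigma_0$: let $I=\{1,\dots,k\}\times\mathbb{N}$, $I_j=\{j\}\times\mathbb{N}$, and let $\mathfrak{G}$ be the group of all permutations $\pi$ of $I$ with $\pi(\xi)\in I_j$ for all $j\in\{1,\dots,k\}$ and all $\xi\in I_j$. For $\pi\in\mathfrak{G}$ let $\alpha^\pi$ be the image predicate, $\alpha^\pi(\pi(\xi_1),\dots,\pi(\xi_n))=\alpha(\xi_1,\dots,\xi_n)$. Then $k\Sigma_0=(J_n)_{n\ge0}$ with $J_0=I$ and, for $n\ge1$, $J_n$ the set of all $n$-ary predicates $\alpha$ on $I$ for which there is a finite $P\subseteq I$ such that $\alpha^\pi=\alpha$ for every $\pi\in\mathfrak{G}$ fixing every element of $P$. Trichotomy: $TR^n=\forall A\,\forall B\,([A\lesssim B]\lor[B\lesssim A])$, where $A,B$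 are variables of sort $n$ and $[A\lesssim B]$ is the second-order formula stating that there is a predicate of sort $2n$ (in the structure) that is (the graph of) a one-to-one function from $A$ into $B$: with $\boldsymbol{x},\boldsymbol{x}',\boldsymbol{y}$ denoting $n$-tuples of individual variables, there is $R$ of sort $2n$ such that for every $\boldsymbol{x}$ with $A\boldsymbol{x}$ there is exactly one $\boldsymbol{y}$ with $B\boldsymbol{y}\land R\boldsymbol{x}\boldsymbol{y}$, and $A\boldsymbol{x}\land A\boldsymbol{x}'\land B\boldsymbol{y}\land R\boldsymbol{x}\boldsymbol{y}\land R\boldsymbol{x}'\boldsymbol{y}$ implies $\boldsymbol{x}=\boldsymbol{x}'$. *)

theory Defs
  imports Main "HOL-Combinatorics.Permutations"
begin

section \<open>Second-order formulas\<close>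

text \<open>Individual variables are natural numbers; for each sort there are countably many predicate
  variables.\<close>

datatype pvar = PVar (sort: nat) (index: nat)

datatype form =
    EqI nat nat
  | App pvar "nat list"
  | Neg form
  | Conj form form
  | Disj form form
  | Impl form form
  | Equi form form
  | AllI nat form
  | ExI nat form
  | AllP pvar form
  | ExP pvar form

primrec wf_form :: "form \<Rightarrow> bool" where
  "wf_form (EqI x y) \<longleftrightarrow> True"
| "wf_form (App V xs) \<longleftrightarrow> sort V \<ge> 1 \<and> length xs = sort V"
| "wf_form (Neg \<phi>) \<longleftrightarrow> wf_form \<phi>"
| "wf_form (Conj \<phi> \<psi>) \<longleftrightarrow> wf_form \<phi> \<and> wf_form \<psi>"
| "wf_form (Disj \<phi> \<psi>) \<longleftrightarrow> wf_form \<phi> \<and> wf_form \<psi>"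
| "wf_form (Impl \<phi> \<psi>) \<longleftrightarrow> wf_form \<phi> \<and> wf_form \<psi>"
| "wf_form (Equi \<phi> \<psi>) \<longleftrightarrow> wf_form \<phi> \<and> wf_form \<psi>"
| "wf_form (AllI x \<phi>) \<longleftrightarrow> wf_form \<phi>"
| "wf_form (ExI x \<phi>) \<longleftrightarrow> wf_form \<phi>"
| "wf_form (AllP V \<phi>) \<longleftrightarrow> sort V \<ge> 1 \<and> wf_form \<phi>"
| "wf_form (ExP V \<phi>) \<longleftrightarrow> sort V \<ge> 1 \<and> wf_form \<phi>"

section \<open>Predicate structures and Henkin semantics\<close>

definition tuples :: "nat \<Rightarrow> 'a set \<Rightarrow> 'a list set" where
  "tuples n I = {xs. length xs = n \<and> set xs \<subseteq> I}"

text \<open>A structure \<open>(J\<^sub>n)\<close> has \<open>J\<^sub>0 = indivs\<close> and \<open>J\<^sub>n = preds n\<close> for \<open>n \<ge> 1\<close>; the value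
  \<open>preds 0\<close> is never used. An \<open>n\<close>-ary predicate is identified with a set of \<open>n\<close>-tuples.\<close>

record 'a pred_struct =
  indivs :: "'a set"
  preds :: "nat \<Rightarrow> 'a list set set"

definition predicate_structure :: "'a pred_struct \<Rightarrow> bool" where
  "predicate_structure \<Sigma> \<longleftrightarrow> indivs \<Sigma> \<noteq> {} \<and>
     (\<forall>n\<ge>1. preds \<Sigma> n \<noteq> {} \<and> preds \<Sigma> n \<subseteq> Pow (tuples n (indivs \<Sigma>)))"

primrec sat :: "'a pred_struct \<Rightarrow> (nat \<Rightarrow> 'a) \<Rightarrow> (pvar \<Rightarrow> 'a list set) \<Rightarrow> form \<Rightarrow> bool" where
  "sat \<Sigma> e F (EqI x y) \<longleftrightarrow> e x = e y"
| "sat \<Sigma> e F (App V xs) \<longleftrightarrow> map e xs \<in> F V"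
| "sat \<Sigma> e F (Neg \<phi>) \<longleftrightarrow> \<not> sat \<Sigma> e F \<phi>"
| "sat \<Sigma> e F (Conj \<phi> \<psi>) \<longleftrightarrow> sat \<Sigma> e F \<phi> \<and> sat \<Sigma> e F \<psi>"
| "sat \<Sigma> e F (Disj \<phi> \<psi>) \<longleftrightarrow> sat \<Sigma> e F \<phi> \<or> sat \<Sigma> e F \<psi>"
| "sat \<Sigma> e F (Impl \<phi> \<psi>) \<longleftrightarrow> (sat \<Sigma> e F \<phi> \<longrightarrow> sat \<Sigma> e F \<psi>)"
| "sat \<Sigma> e F (Equi \<phi> \<psi>) \<longleftrightarrow> (sat \<Sigma> e F \<phi> \<longleftrightarrow> sat \<Sigma> e F \<psi>)"
| "sat \<Sigma> e F (AllI x \<phi>) \<longleftrightarrow> (\<forall>\<xi>\<in>indivs \<Sigma>. sat \<Sigma> (e(x := \<xi>)) F \<phi>)"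
| "sat \<Sigma> e F (ExI x \<phi>) \<longleftrightarrow> (\<exists>\<xi>\<in>indivs \<Sigma>. sat \<Sigma> (e(x := \<xi>)) F \<phi>)"
| "sat \<Sigma> e F (AllP V \<phi>) \<longleftrightarrow> (\<forall>\<alpha>\<in>preds \<Sigma> (sort V). sat \<Sigma> e (F(V := \<alpha>)) \<phi>)"
| "sat \<Sigma> e F (ExP V \<phi>) \<longleftrightarrow> (\<exists>\<alpha>\<in>preds \<Sigma> (sort V). sat \<Sigma> e (F(V := \<alpha>)) \<phi>)"

definition assignment :: "'a pred_struct \<Rightarrow> (nat \<Rightarrow> 'a) \<Rightarrow> (pvar \<Rightarrow> 'a list set) \<Rightarrow> bool" where
  "assignment \<Sigma> e F \<longleftrightarrow>
     (\<forall>x. e x \<in> indivs \<Sigma>) \<and> (\<forall>V. sort V \<ge> 1 \<longrightarrow> F V \<in> preds \<Sigma> (sort V))"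

definition models :: "'a pred_struct \<Rightarrow> form \<Rightarrow> bool" (infix "\<Turnstile>" 50) where
  "\<Sigma> \<Turnstile> \<phi> \<longleftrightarrow> (\<forall>e F. assignment \<Sigma> e F \<longrightarrow> sat \<Sigma> e F \<phi>)"

section \<open>Trichotomy\<close>

definition AllIs :: "nat list \<Rightarrow> form \<Rightarrow> form" where
  "AllIs xs \<phi> = foldr AllI xs \<phi>"

definition ExIs :: "nat list \<Rightarrow> form \<Rightarrow> form" where
  "ExIs xs \<phi> = foldr ExI xs \<phi>"

text \<open>Equality of two non-empty tuples of variables of the same length.\<close>

definition EqIs :: "nat list \<Rightarrow> nat list \<Rightarrow> form" where
  "EqIs xs ys = foldr Conj (map2 EqI (tl xs) (tl ys)) (EqI (hd xs) (hd ys))"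

text \<open>\<open>A\<close> and \<open>B\<close> are meant to be of sort \<open>n \<ge> 1\<close>. They then differ from the bound variable \<open>R\<close>,
  whose sort is \<open>2 * n\<close>. The first conjunct spells out ``there is exactly one \<open>y\<close>'', with \<open>y'\<close>
  an auxiliary tuple.\<close>

definition lesssim :: "nat \<Rightarrow> pvar \<Rightarrow> pvar \<Rightarrow> form" where
  "lesssim n A B =
    (let R = PVar (2 * n) 0;
         x = [0..<n]; x' = [n..<2 * n]; y = [2 * n..<3 * n]; y' = [3 * n..<4 * n]
     in ExP R (Conj
          (AllIs x (Impl (App A x)
             (ExIs y (Conj (Conj (App B y) (App R (x @ y)))
                (AllIs y' (Impl (Conj (App B y') (App R (x @ y'))) (EqIs y' y)))))))
          (AllIs x (AllIs x' (AllIs y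
             (Impl (Conj (App A x) (Conj (App A x') (Conj (App B y)
                     (Conj (App R (x @ y)) (App R (x' @ y))))))
                (EqIs x x')))))))"

definition TR :: "nat \<Rightarrow> form" where
  "TR n = (let A = PVar n 0; B = PVar n 1
           in AllP A (AllP B (Disj (lesssim n A B) (lesssim n B A))))"

section \<open>The model \<open>k\<Sigma>\<^sub>0\<close>\<close>

definition block :: "nat \<Rightarrow> (nat \<times> nat) set" where
  "block j = {j} \<times> UNIV"

definition blocks :: "nat \<Rightarrow> (nat \<times> nat) set" where
  "blocks k = {1..k} \<times> UNIV"

definition block_group :: "nat \<Rightarrow> (nat \<times> nat \<Rightarrow> nat \<times> nat) set" where
  "block_group k =
     {\<pi>. \<pi> permutes blocks k \<and> (\<forall>j\<in>{1..k}. \<forall>\<xi>\<in>block j. \<pi> \<xi> \<in> block j)}"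

definition image_predicate :: "('a \<Rightarrow> 'a) \<Rightarrow> 'a list set \<Rightarrow> 'a list set" where
  "image_predicate \<pi> \<alpha> = map \<pi> ` \<alpha>"

definition kSigma0 :: "nat \<Rightarrow> (nat \<times> nat) pred_struct" where
  "kSigma0 k =
     \<lparr>indivs = blocks k,
      preds = (\<lambda>n. {\<alpha>. \<alpha> \<subseteq> tuples n (blocks k) \<and>
        (\<exists>P. finite P \<and> P \<subseteq> blocks k \<and>
          (\<forall>\<pi>\<in>block_group k. (\<forall>\<xi>\<in>P. \<pi> \<xi> = \<xi>) \<longrightarrow> image_predicate \<pi> \<alpha> = \<alpha>))})\<rparr>"

section \<open>Basic checks\<close>

lemma predicate_structure_kSigma0:
  assumes "k \<ge> 1"
  shows "predicate_structure (kSigma0 k)"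
proof -
  have "{} \<in> preds (kSigma0 k) n" for n
    by (auto simp: kSigma0_def image_predicate_def)
  moreover have "(1, 0) \<in> indivs (kSigma0 k)"
    using assms by (auto simp: kSigma0_def blocks_def)
  moreover have "preds (kSigma0 k) n \<subseteq> Pow (tuples n (indivs (kSigma0 k)))" for n
    by (auto simp: kSigma0_def)
  ultimately show ?thesis
    unfolding predicate_structure_def by blast
qed

lemma wf_form_AllIs [simp]: "wf_form (AllIs xs \<phi>) = wf_form \<phi>"
  unfolding AllIs_def by (induction xs) auto

lemma wf_form_ExIs [simp]: "wf_form (ExIs xs \<phi>) = wf_form \<phi>"
  unfolding ExIs_def by (induction xs) auto

lemma wf_form_EqIs [simp]: "wf_form (EqIs xs ys)"
proof -
  have "wf_form (foldr Conj (map2 EqI us vs) (EqI x y))" for us vs x y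
    by (induction us vs rule: list_induct2') auto
  then show ?thesis
    by (simp add: EqIs_def)
qed

lemma wf_form_TR: "n \<ge> 1 \<Longrightarrow> wf_form (TR n)"
  by (simp add: TR_def lesssim_def Let_def)

end

theory Submission
  imports Defs
begin

text \<open>Take for \<open>A\<close> and \<open>B\<close> the diagonals \<open>{(\<xi>, \<dots>, \<xi>)}\<close> over two different blocks. An injection
  \<open>R\<close> of \<open>A\<close> into \<open>B\<close> with finite support \<open>P\<close> is invariant under the transposition of two elements
  \<open>a, a'\<close> outside \<open>P\<close> of the first block. This transposition fixes the second block pointwise, so
  \<open>R\<close> relates \<open>(a, \<dots>, a)\<close> and \<open>(a', \<dots>, a')\<close> to the same tuple.\<close>

text \<open>Speaking of whole assignments \<open>e'\<close> that agree with \<open>e\<close> off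
  \<open>xs\<close> avoids nested updates and asks no distinctness of \<open>xs\<close>: a repeated
  variable is rebound and only its innermost value survives.\<close>

lemma sat_AllIs:
  "sat \<Sigma> e F (AllIs xs \<phi>) \<longleftrightarrow>
    (\<forall>e'. (\<forall>x. x \<notin> set xs \<longrightarrow> e' x = e x) \<and> (\<forall>x\<in>set xs. e' x \<in> indivs \<Sigma>) \<longrightarrow> sat \<Sigma> e' F \<phi>)"
proof (induction xs arbitrary: e)
  case Nil
  have "e' = e" if "\<forall>x. e' x = e x" for e'
    using that by auto
  then show ?case
    by (auto simp: AllIs_def)
next
  case (Cons z xs)
  have step: "sat \<Sigma> e F (AllIs (z # xs) \<phi>) \<longleftrightarrow>
      (\<forall>\<xi>\<in>indivs \<Sigma>. sat \<Sigma> (e(z := \<xi>)) F (AllIs xs \<phi>))"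
    by (simp add: AllIs_def)
  show ?case
  proof
    assume L: "sat \<Sigma> e F (AllIs (z # xs) \<phi>)"
    show "\<forall>e'. (\<forall>x. x \<notin> set (z # xs) \<longrightarrow> e' x = e x) \<and> (\<forall>x\<in>set (z # xs). e' x \<in> indivs \<Sigma>)
        \<longrightarrow> sat \<Sigma> e' F \<phi>"
    proof (intro allI impI)
      fix e'
      assume e': "(\<forall>x. x \<notin> set (z # xs) \<longrightarrow> e' x = e x) \<and> (\<forall>x\<in>set (z # xs). e' x \<in> indivs \<Sigma>)"
      then have "sat \<Sigma> (e(z := e' z)) F (AllIs xs \<phi>)"
        using L step by auto
      then show "sat \<Sigma> e' F \<phi>"
        unfolding Cons.IH using e' by auto
    qed
  next
    assume R: "\<forall>e'. (\<forall>x. x \<notin> set (z # xs) \<longrightarrow> e' x = e x) \<and>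
        (\<forall>x\<in>set (z # xs). e' x \<in> indivs \<Sigma>) \<longrightarrow> sat \<Sigma> e' F \<phi>"
    show "sat \<Sigma> e F (AllIs (z # xs) \<phi>)"
      unfolding step Cons.IH
    proof (intro ballI allI impI)
      fix \<xi> e'
      assume "\<xi> \<in> indivs \<Sigma>"
        and "(\<forall>x. x \<notin> set xs \<longrightarrow> e' x = (e(z := \<xi>)) x) \<and> (\<forall>x\<in>set xs. e' x \<in> indivs \<Sigma>)"
      \<comment> \<open>If \<open>z\<close> recurs in \<open>xs\<close>, the inner quantifiers
        already put \<open>e' z\<close> into the domain; otherwise
        \<open>e' z = \<xi>\<close>.\<close>
      then show "sat \<Sigma> e' F \<phi>"
        by (intro R[rule_format]) (cases "z \<in> set xs"; auto)
    qed
  qed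
qed

lemma sat_ExIs:
  "sat \<Sigma> e F (ExIs xs \<phi>) \<longleftrightarrow>
    (\<exists>e'. (\<forall>x. x \<notin> set xs \<longrightarrow> e' x = e x) \<and> (\<forall>x\<in>set xs. e' x \<in> indivs \<Sigma>) \<and> sat \<Sigma> e' F \<phi>)"
proof -
  \<comment> \<open>Duality of the quantifiers reduces this to \<open>sat_AllIs\<close>.\<close>
  have "sat \<Sigma> e F (ExIs xs \<phi>) \<longleftrightarrow> \<not> sat \<Sigma> e F (AllIs xs (Neg \<phi>))"
    by (induction xs arbitrary: e) (auto simp: ExIs_def AllIs_def)
  then show ?thesis
    by (auto simp: sat_AllIs)
qed

lemma sat_EqIs:
  assumes "length xs = length ys" and "xs \<noteq> []"
  shows "sat \<Sigma> e F (EqIs xs ys) \<longleftrightarrow> map e xs = map e ys"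
proof -
  \<comment> \<open>\<open>EqIs\<close> folds the tails around the equation of the heads, which
    stays innermost and fixed during the induction.\<close>
  have *: "sat \<Sigma> e F (foldr Conj (map2 EqI us vs) (EqI x y)) \<longleftrightarrow>
      e x = e y \<and> map e us = map e vs" if "length us = length vs" for us vs x y
    using that by (induction us vs rule: list_induct2) auto
  from assms show ?thesis
    by (cases xs; cases ys) (auto simp: EqIs_def *)
qed

lemma map_eq_replicate:
  "(\<And>x. x \<in> set xs \<Longrightarrow> f x = c) \<Longrightarrow> length xs = n \<Longrightarrow> map f xs = replicate n c"
  by (induction xs arbitrary: n) auto

text \<open>The group is defined by inclusions only. Equality follows because each point of the
  block has a preimage in some block, and that block must be the same one.\<close>

lemma block_group_image_block:
  assumes "\<pi> \<in> block_group k" and "j \<in> {1..k}"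
  shows "\<pi> ` block j = block j"
proof (intro equalityI subsetI)
  show "\<xi> \<in> block j" if "\<xi> \<in> \<pi> ` block j" for \<xi>
    using that assms by (auto simp: block_group_def)
next
  fix \<xi> assume \<xi>: "\<xi> \<in> block j"
  from assms have \<pi>: "\<pi> permutes blocks k"
    by (auto simp: block_group_def)
  have "\<xi> \<in> \<pi> ` blocks k"
    using \<xi> assms(2) permutes_image[OF \<pi>] by (auto simp: block_def blocks_def)
  then obtain j' m where j': "\<xi> = \<pi> (j', m)" "j' \<in> {1..k}"
    by (auto simp: blocks_def)
  then have "\<xi> \<in> block j'"
    using assms(1) by (auto simp: block_group_def block_def)
  with \<xi> have "j' = j"
    by (auto simp: block_def)
  with j' show "\<xi> \<in> \<pi> ` block j"
    by (auto simp: block_def)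
qed

lemma transpose_in_block_group:
  assumes "j \<in> {1..k}" "a \<in> block j" "a' \<in> block j"
  shows "transpose a a' \<in> block_group k"
proof -
  have "transpose a a' permutes blocks k"
    using assms by (intro permutes_swap_id) (auto simp: block_def blocks_def)
  then show ?thesis
    using assms by (auto simp: block_group_def block_def transpose_def)
qed

text \<open>An \<open>n\<close>-ary copy of a block, which makes the argument for sort
  \<open>n\<close> the one for sets of individuals.\<close>

definition diagonal :: "nat \<Rightarrow> nat \<Rightarrow> (nat \<times> nat) list set" where
  "diagonal n j = replicate n ` block j"

text \<open>Every group element maps the block onto itself, so the empty set is a support.\<close>

lemma diagonal_in_preds:
  assumes "j \<in> {1..k}"
  shows "diagonal n j \<in> preds (kSigma0 k) n"
proof -
  have "diagonal n j \<subseteq> tuples n (blocks k)"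
    using assms by (auto simp: diagonal_def tuples_def block_def blocks_def)
  moreover have "image_predicate \<pi> (diagonal n j) = diagonal n j" if "\<pi> \<in> block_group k" for \<pi>
  proof -
    have "image_predicate \<pi> (diagonal n j) = replicate n ` \<pi> ` block j"
      by (simp add: image_predicate_def diagonal_def image_image)
    then show ?thesis
      using block_group_image_block[OF that assms] by (simp add: diagonal_def)
  qed
  ultimately show ?thesis
    by (auto simp: kSigma0_def)
qed

lemma infinite_block: "infinite (block j)"
  by (auto simp: block_def finite_cartesian_product_iff)

text \<open>The combinatorial core, free of formulas: a finitely supported relation that is total
  between two blocks has two sources with a common target.\<close>

lemma supported_relation_not_injective:
  assumes R: "R \<in> preds (kSigma0 k) m"
    and ij: "i \<in> {1..k}" "i \<noteq> j"
    and total: "\<And>a. a \<in> block i \<Longrightarrow> \<exists>b\<in>block j. replicate n a @ replicate n b \<in> R"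
  obtains a a' b where "a \<in> block i" "a' \<in> block i" "b \<in> block j" "a \<noteq> a'"
    "replicate n a @ replicate n b \<in> R" "replicate n a' @ replicate n b \<in> R"
proof -
  from R obtain P where P: "finite P"
    and inv: "\<And>\<pi>. \<pi> \<in> block_group k \<Longrightarrow> \<forall>\<xi>\<in>P. \<pi> \<xi> = \<xi> \<Longrightarrow> image_predicate \<pi> R = R"
    by (auto simp: kSigma0_def)
  obtain a where a: "a \<in> block i" "a \<notin> P"
    using infinite_block P by (meson finite_subset subsetI)
  \<comment> \<open>Removing \<open>a\<close> along with \<open>P\<close> still leaves infinitely
    many points and forces \<open>a' \<noteq> a\<close>.\<close>
  obtain a' where a': "a' \<in> block i" "a' \<notin> insert a P"
    using infinite_block P by (meson finite_insert finite_subset subsetI)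
  obtain b where b: "b \<in> block j" "replicate n a @ replicate n b \<in> R"
    using total a by blast
  have "map (transpose a a') (replicate n a @ replicate n b) \<in> image_predicate (transpose a a') R"
    using b(2) by (auto simp: image_predicate_def simp del: map_append)
  also have "\<dots> = R"
    using a a' by (intro inv transpose_in_block_group[OF ij(1)]) (auto simp: transpose_def)
  finally have "map (transpose a a') (replicate n a @ replicate n b) \<in> R" .
  \<comment> \<open>\<open>b\<close> lies in another block than \<open>a\<close> and
    \<open>a'\<close>.\<close>
  moreover have "transpose a a' b = b"
    using a a' b ij by (auto simp: block_def transpose_def)
  ultimately have "replicate n a' @ replicate n b \<in> R"
    by simp
  with a a' b show thesis
    by (intro that[of a a' b]) auto
qed

text \<open>Carries the combinatorial fact over to the formula. \<open>A\<close> and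
  \<open>B\<close> must differ from the bound variable for \<open>R\<close>, so that its update of
  \<open>F\<close> leaves the diagonals in place.\<close>

lemma not_lesssim_diagonal:
  assumes n: "n \<ge> 1" and ij: "i \<in> {1..k}" "j \<in> {1..k}" "i \<noteq> j"
    and A: "A \<noteq> PVar (2 * n) 0" "F A = diagonal n i"
    and B: "B \<noteq> PVar (2 * n) 0" "F B = diagonal n j"
  shows "\<not> sat (kSigma0 k) e F (lesssim n A B)"
proof
  assume "sat (kSigma0 k) e F (lesssim n A B)"
  then obtain R where R: "R \<in> preds (kSigma0 k) (2 * n)"
    and ex: "sat (kSigma0 k) e (F(PVar (2 * n) 0 := R))
      (AllIs [0..<n] (Impl (App A [0..<n]) (ExIs [2 * n..<3 * n]
        (Conj (Conj (App B [2 * n..<3 * n]) (App (PVar (2 * n) 0) ([0..<n] @ [2 * n..<3 * n])))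
          (AllIs [3 * n..<4 * n]
            (Impl (Conj (App B [3 * n..<4 * n])
                (App (PVar (2 * n) 0) ([0..<n] @ [3 * n..<4 * n])))
              (EqIs [3 * n..<4 * n] [2 * n..<3 * n])))))))"
    and inj: "sat (kSigma0 k) e (F(PVar (2 * n) 0 := R))
      (AllIs [0..<n] (AllIs [n..<2 * n] (AllIs [2 * n..<3 * n]
        (Impl (Conj (App A [0..<n]) (Conj (App A [n..<2 * n]) (Conj (App B [2 * n..<3 * n])
            (Conj (App (PVar (2 * n) 0) ([0..<n] @ [2 * n..<3 * n]))
              (App (PVar (2 * n) 0) ([n..<2 * n] @ [2 * n..<3 * n]))))))
          (EqIs [0..<n] [n..<2 * n])))))"
    by (auto simp: lesssim_def Let_def)
  have sub: "\<xi> \<in> indivs (kSigma0 k)" if "\<xi> \<in> block i \<union> block j" for \<xi>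
    using that ij by (auto simp: kSigma0_def block_def blocks_def)
  have total: "\<exists>b\<in>block j. replicate n a @ replicate n b \<in> R" if a: "a \<in> block i" for a
  proof -
    \<comment> \<open>The tuple \<open>x\<close> becomes \<open>(a, ..., a)\<close>.\<close>
    define e1 where "e1 x = (if x < n then a else e x)" for x
    have x1: "map e1 [0..<n] = replicate n a"
      by (intro map_eq_replicate) (auto simp: e1_def)
    have "sat (kSigma0 k) e1 (F(PVar (2 * n) 0 := R)) (ExIs [2 * n..<3 * n]
        (Conj (Conj (App B [2 * n..<3 * n]) (App (PVar (2 * n) 0) ([0..<n] @ [2 * n..<3 * n])))
          (AllIs [3 * n..<4 * n]
            (Impl (Conj (App B [3 * n..<4 * n])
                (App (PVar (2 * n) 0) ([0..<n] @ [3 * n..<4 * n])))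
              (EqIs [3 * n..<4 * n] [2 * n..<3 * n])))))"
      using ex[unfolded sat_AllIs, rule_format, of e1] a sub A x1
      by (auto simp: e1_def diagonal_def)
    then obtain e2 where "\<forall>x. x \<notin> set [2 * n..<3 * n] \<longrightarrow> e2 x = e1 x"
      "sat (kSigma0 k) e2 (F(PVar (2 * n) 0 := R))
        (Conj (App B [2 * n..<3 * n]) (App (PVar (2 * n) 0) ([0..<n] @ [2 * n..<3 * n])))"
      unfolding sat_ExIs by auto
    then have e2: "\<forall>x. x \<notin> {2 * n..<3 * n} \<longrightarrow> e2 x = e1 x"
      "map e2 [2 * n..<3 * n] \<in> diagonal n j" "map e2 [0..<n] @ map e2 [2 * n..<3 * n] \<in> R"
      using B by auto
    \<comment> \<open>The variables of \<open>y\<close> start at \<open>2 * n\<close>, so choosing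
      values for them leaves \<open>x\<close> unchanged.\<close>
    have "map e2 [0..<n] = replicate n a"
      using e2(1) by (intro map_eq_replicate) (auto simp: e1_def)
    with e2 show ?thesis
      by (auto simp: diagonal_def)
  qed
  obtain a a' b where ab: "a \<in> block i" "a' \<in> block i" "b \<in> block j" "a \<noteq> a'"
    "replicate n a @ replicate n b \<in> R" "replicate n a' @ replicate n b \<in> R"
    using supported_relation_not_injective[OF R ij(1,3) total] by blast
  \<comment> \<open>One assignment per quantifier block, each changing only its own range of
    indices: \<open>x\<close> gets \<open>a\<close>, \<open>x'\<close> gets \<open>a'\<close>,
    \<open>y\<close> gets \<open>b\<close>.\<close>
  define e1 where "e1 x = (if x < n then a else e x)" for x
  define e2 where "e2 x = (if n \<le> x \<and> x < 2 * n then a' else e1 x)" for x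
  define e3 where "e3 x = (if 2 * n \<le> x \<and> x < 3 * n then b else e2 x)" for x
  have "map e3 [0..<n] = replicate n a" "map e3 [n..<2 * n] = replicate n a'"
    "map e3 [2 * n..<3 * n] = replicate n b"
    by (intro map_eq_replicate; auto simp: e1_def e2_def e3_def)+
  note maps = this
  have "sat (kSigma0 k) e3 (F(PVar (2 * n) 0 := R))
      (Impl (Conj (App A [0..<n]) (Conj (App A [n..<2 * n]) (Conj (App B [2 * n..<3 * n])
            (Conj (App (PVar (2 * n) 0) ([0..<n] @ [2 * n..<3 * n]))
              (App (PVar (2 * n) 0) ([n..<2 * n] @ [2 * n..<3 * n]))))))
          (EqIs [0..<n] [n..<2 * n]))"
    using ab sub
    by (intro inj[unfolded sat_AllIs, rule_format, of e1 e2 e3])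
      (auto simp: e1_def e2_def e3_def)
  \<comment> \<open>All premises of the injectivity clause hold at \<open>e3\<close>. Its conclusion
    equates the constant tuples, hence \<open>a = a'\<close> because
    \<open>n \<ge> 1\<close>.\<close>
  then have "replicate n a = replicate n a'"
    using n A B ab by (simp add: sat_EqIs maps diagonal_def)
  with n ab(4) show False
    by simp
qed

theorem proposition4p4:
  fixes k n :: nat
  assumes "k \<ge> 2" and "n \<ge> 1"
  shows "kSigma0 k \<Turnstile> Neg (TR n)"
  unfolding models_def
proof (intro allI impI)
  fix e F
  \<comment> \<open>Blocks 1 and 2 exist since \<open>k \<ge> 2\<close>. Their roles are
    interchangeable, so both disjuncts of trichotomy fail; the sorts \<open>n\<close> and
    \<open>2 * n\<close> differ since \<open>n \<ge> 1\<close>.\<close>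
  let ?F = "F(PVar n 0 := diagonal n 1, PVar n 1 := diagonal n 2)"
  have "\<not> sat (kSigma0 k) e ?F (lesssim n (PVar n 0) (PVar n 1))"
    "\<not> sat (kSigma0 k) e ?F (lesssim n (PVar n 1) (PVar n 0))"
    using assms by (intro not_lesssim_diagonal[of n 1 k 2] not_lesssim_diagonal[of n 2 k 1]; simp)+
  moreover have "diagonal n 1 \<in> preds (kSigma0 k) n" "diagonal n 2 \<in> preds (kSigma0 k) n"
    using assms by (auto intro: diagonal_in_preds)
  ultimately show "sat (kSigma0 k) e F (Neg (TR n))"
    by (auto simp: TR_def Let_def)
qed

end
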